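(* Let $(Q,+)$ be a group, $\varphi,\psi\in Aut(Q,+)$, and $\beta,\delta\in S_Q$. The left linear quasigroup $(Q,\cdot)$ given by $x\cdot y=\varphi x+\beta y$ and the left alinear quasigroup $(Q,\circ)$ given by $x\circ y=I\psi x+\delta y$ are orthogonal if and only if for every $b\in Q$ the mapping $(\psi^{-1}\delta+J_{I\psi^{-1}b}\varphi^{-1}\beta)$, i.e. $y\mapsto\psi^{-1}\delta y+J_{I\psi^{-1}b}\varphi^{-1}\beta y$, is a permutation of the set $Q$.
   Context: Groups are written additively but need not be commutative. $S_Q$ is the set of all permutations (bijections) of the set $Q$. Products of maps are compositions, $(\alpha\beta)x=\alpha(\beta x)$. $I$ denotes the map $Ix=-x$, and for $t\in Q$, $J_t$ is the inner automorphism $J_tx=t+x-t$. Two quasigroups $(Q,\cdot)$ and $(Q,\circ)$ on the same set are orthogonal if for all $a,b\in Q$ the system $x\cdot y=a$, $x\circ y=b$ has a unique solution $(x,y)\in Q\times Q$. *)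

theory Defs
  imports Main
begin

text \<open>A (not necessarily commutative) group \<open>(Q, +)\<close> is a type of class \<^class>\<open>group_add\<close>,
  with \<open>Q\<close> the whole type; permutations of \<open>Q\<close> are the functions satisfying \<^const>\<open>bij\<close>.\<close>

definition group_aut :: "('a::group_add \<Rightarrow> 'a) \<Rightarrow> bool" where
  "group_aut f \<longleftrightarrow> bij f \<and> (\<forall>x y. f (x + y) = f x + f y)"

definition inner_aut :: "'a::group_add \<Rightarrow> 'a \<Rightarrow> 'a" where
  "inner_aut t x = t + x - t"

definition quasigroup :: "('a \<Rightarrow> 'a \<Rightarrow> 'a) \<Rightarrow> bool" where
  "quasigroup f \<longleftrightarrow> (\<forall>a b. \<exists>!x. f a x = b) \<and> (\<forall>a b. \<exists>!y. f y a = b)"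

text \<open>Orthogonality is a relation between quasigroups, so being a quasigroup is part of it.\<close>

definition orthogonal_quasigroups :: "('a \<Rightarrow> 'a \<Rightarrow> 'a) \<Rightarrow> ('a \<Rightarrow> 'a \<Rightarrow> 'a) \<Rightarrow> bool" where
  "orthogonal_quasigroups f g \<longleftrightarrow> quasigroup f \<and> quasigroup g \<and>
     (\<forall>a b. \<exists>!(x, y). f x y = a \<and> g x y = b)"

definition left_linear_op :: "('a::group_add \<Rightarrow> 'a) \<Rightarrow> ('a \<Rightarrow> 'a) \<Rightarrow> 'a \<Rightarrow> 'a \<Rightarrow> 'a" where
  "left_linear_op \<phi> \<beta> x y = \<phi> x + \<beta> y"

definition left_alinear_op :: "('a::group_add \<Rightarrow> 'a) \<Rightarrow> ('a \<Rightarrow> 'a) \<Rightarrow> 'a \<Rightarrow> 'a \<Rightarrow> 'a" where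
  "left_alinear_op \<psi> \<delta> x y = - \<psi> x + \<delta> y"

lemma quasigroup_add_bij:
  fixes \<alpha> \<beta> :: "'a::group_add \<Rightarrow> 'a"
  assumes "bij \<alpha>" "bij \<beta>"
  shows "quasigroup (\<lambda>x y. \<alpha> x + \<beta> y)"
proof -
  have l: "(\<alpha> a + \<beta> x = b) = (\<beta> x = - \<alpha> a + b)" for a b x
    by (metis add.assoc add.left_neutral left_minus right_minus)
  have r: "(\<alpha> y + \<beta> a = b) = (\<alpha> y = b - \<beta> a)" for a b y
    by (simp add: eq_diff_eq)
  have "\<forall>a b. \<exists>!x. \<alpha> a + \<beta> x = b"
    unfolding l using assms(2) by (simp add: bij_iff)
  moreover have "\<forall>a b. \<exists>!y. \<alpha> y + \<beta> a = b"
    unfolding r using assms(1) by (simp add: bij_iff)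
  ultimately show ?thesis
    by (simp add: quasigroup_def)
qed

lemma quasigroup_left_linear_op:
  assumes "group_aut \<phi>" "bij \<beta>"
  shows "quasigroup (left_linear_op \<phi> \<beta>)"
  using quasigroup_add_bij[of \<phi> \<beta>] assms
  by (simp add: group_aut_def left_linear_op_def[abs_def])

lemma quasigroup_left_alinear_op:
  assumes "group_aut \<psi>" "bij \<delta>"
  shows "quasigroup (left_alinear_op \<psi> \<delta>)"
proof -
  have "bij (\<lambda>x. - \<psi> x)"
    using assms(1) unfolding group_aut_def bij_iff by (metis minus_minus)
  then show ?thesis
    using quasigroup_add_bij[of "\<lambda>x. - \<psi> x" \<delta>] assms(2)
    by (simp add: left_alinear_op_def[abs_def])
qed

end

theory Submission
  imports Defs
begin

text \<open>Solving the first equation for \<open>x\<close> gives \<open>x = \<phi>\<inverse>a - \<phi>\<inverse>\<beta>y\<close>, and applying \<open>\<psi>\<inverse>\<close> to the second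
  gives \<open>\<psi>\<inverse>\<delta>y = x + \<psi>\<inverse>b\<close>. Eliminating \<open>x\<close> leaves \<open>F\<^sub>b y = \<phi>\<inverse>a + \<psi>\<inverse>b\<close>, where \<open>F\<^sub>b\<close> is the mapping
  of the theorem. For fixed \<open>b\<close> the right-hand side runs through the whole group with \<open>a\<close>, so unique
  solvability for all \<open>a\<close> says that \<open>F\<^sub>b\<close> is a permutation.\<close>

lemma group_aut_inv_add:
  assumes "group_aut f"
  shows "inv f (x + y) = inv f x + inv f y"
proof (rule inv_f_eq)
  show "inj f"
    using assms by (simp add: group_aut_def bij_is_inj)
  show "f (inv f x + inv f y) = x + y"
    using assms by (simp add: group_aut_def bij_is_surj surj_f_inv_f)
qed

text \<open>Once \<open>x\<close> is a function of \<open>y\<close>, solution pairs correspond to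
  values of \<open>y\<close>; this removes \<open>x\<close> from the orthogonality
  condition.\<close>

lemma Ex1_pair_determined:
  "(\<exists>!(x, y). x = h y \<and> P y) \<longleftrightarrow> (\<exists>!y. P y)"
  by auto

lemma linear_alinear_system_iff:
  fixes \<phi> \<psi> \<beta> \<delta> :: "'a::group_add \<Rightarrow> 'a"
  assumes "group_aut \<phi>" and "group_aut \<psi>"
  shows "left_linear_op \<phi> \<beta> x y = a \<and> left_alinear_op \<psi> \<delta> x y = b \<longleftrightarrow>
    x = inv \<phi> a - inv \<phi> (\<beta> y) \<and>
    inv \<psi> (\<delta> y) + inner_aut (- inv \<psi> b) (inv \<phi> (\<beta> y)) = inv \<phi> a + inv \<psi> b"
proof -
  have bij: "bij \<phi>" "bij \<psi>"
    using assms by (auto simp: group_aut_def)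
  have "\<phi> x + \<beta> y = a \<longleftrightarrow> inv \<phi> (\<phi> x + \<beta> y) = inv \<phi> a"
    using bij(1) by (metis bij_inv_eq_iff)
  also have "\<dots> \<longleftrightarrow> x = inv \<phi> a - inv \<phi> (\<beta> y)"
    using bij(1) by (simp add: group_aut_inv_add[OF assms(1)] bij_is_inj eq_diff_eq)
  finally have first: "\<phi> x + \<beta> y = a \<longleftrightarrow> x = inv \<phi> a - inv \<phi> (\<beta> y)" .
  have "- \<psi> x + \<delta> y = b \<longleftrightarrow> \<delta> y = \<psi> x + b"
    by (metis add.assoc add.left_neutral left_minus right_minus)
  also have "\<dots> \<longleftrightarrow> inv \<psi> (\<delta> y) = inv \<psi> (\<psi> x + b)"
    using bij(2) by (metis bij_inv_eq_iff)
  also have "\<dots> \<longleftrightarrow> inv \<psi> (\<delta> y) = x + inv \<psi> b"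
    using bij(2) by (simp add: group_aut_inv_add[OF assms(2)] bij_is_inj)
  finally have second: "- \<psi> x + \<delta> y = b \<longleftrightarrow> inv \<psi> (\<delta> y) = x + inv \<psi> b" .
  \<comment> \<open>Right addition of \<open>inner_aut (- c) q\<close>, which is
    \<open>- c + q + c\<close>, cancels \<open>- q + c\<close> and leaves \<open>c\<close>. The
    inner automorphism is the cost of moving \<open>q\<close> past \<open>c\<close> in a
    noncommutative group. It is applied with \<open>p\<close>, \<open>q\<close> the images of
    \<open>a\<close>, \<open>\<beta> y\<close> under \<open>inv \<phi>\<close>, and
    \<open>d\<close>, \<open>c\<close> those of \<open>\<delta> y\<close>, \<open>b\<close> under
    \<open>inv \<psi>\<close>.\<close>
  have eliminate: "d = p - q + c \<longleftrightarrow> d + inner_aut (- c) q = p + c" for d p q c :: 'a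
  proof -
    have "p - q + c + inner_aut (- c) q = p + c"
      by (simp add: inner_aut_def diff_conv_add_uminus add.assoc del: add_uminus_conv_diff)
    then show ?thesis
      by (metis add_right_cancel)
  qed
  show ?thesis
    unfolding left_linear_op_def left_alinear_op_def first second
    using eliminate by blast
qed

theorem theorem33:
  fixes \<phi> \<psi> \<beta> \<delta> :: "'a::group_add \<Rightarrow> 'a"
  assumes "group_aut \<phi>" and "group_aut \<psi>" and "bij \<beta>" and "bij \<delta>"
  shows "orthogonal_quasigroups (left_linear_op \<phi> \<beta>) (left_alinear_op \<psi> \<delta>) \<longleftrightarrow>
    (\<forall>b. bij (\<lambda>y. inv \<psi> (\<delta> y) + inner_aut (- inv \<psi> b) (inv \<phi> (\<beta> y))))"
proof -
  define F where "F b y = inv \<psi> (\<delta> y) + inner_aut (- inv \<psi> b) (inv \<phi> (\<beta> y))" for b y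
  have "orthogonal_quasigroups (left_linear_op \<phi> \<beta>) (left_alinear_op \<psi> \<delta>) \<longleftrightarrow>
      (\<forall>a b. \<exists>!(x, y). left_linear_op \<phi> \<beta> x y = a \<and> left_alinear_op \<psi> \<delta> x y = b)"
    by (simp add: orthogonal_quasigroups_def quasigroup_left_linear_op
        quasigroup_left_alinear_op assms)
  also have "\<dots> \<longleftrightarrow> (\<forall>a b. \<exists>!y. F b y = inv \<phi> a + inv \<psi> b)"
    unfolding linear_alinear_system_iff[OF assms(1,2)] Ex1_pair_determined F_def ..
  also have "\<dots> \<longleftrightarrow> (\<forall>b a. \<exists>!y. F b y = inv \<phi> a + inv \<psi> b)"
    by (rule all_comm)
  also have "\<dots> \<longleftrightarrow> (\<forall>b c. \<exists>!y. F b y = c)"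
  proof (rule all_cong1)
    fix b
    \<comment> \<open>For fixed \<open>b\<close> every \<open>c\<close> is a right-hand side,
      attained at \<open>a = \<phi> (c - inv \<psi> b)\<close>.\<close>
    have surj: "surj (\<lambda>a. inv \<phi> a + inv \<psi> b)"
    proof (rule surjI)
      show "inv \<phi> (\<phi> (c - inv \<psi> b)) + inv \<psi> b = c" for c
        using assms(1) by (simp add: group_aut_def bij_is_inj)
    qed
    show "(\<forall>a. \<exists>!y. F b y = inv \<phi> a + inv \<psi> b) \<longleftrightarrow> (\<forall>c. \<exists>!y. F b y = c)"
      \<comment> \<open>Quantifying over \<open>a\<close> amounts to quantifying over the range of
        the right-hand side, which is \<open>UNIV\<close> by \<open>surj\<close>.\<close>
      using ball_simps(9)[of "\<lambda>a. inv \<phi> a + inv \<psi> b" UNIV "\<lambda>c. \<exists>!y. F b y = c"]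
      unfolding surj by (simp only: ball_UNIV)
  qed
  also have "\<dots> \<longleftrightarrow> (\<forall>b. bij (F b))"
    by (simp add: bij_iff)
  finally show ?thesis
    by (simp add: F_def[abs_def])
qed

end
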